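(* Let $L$ be a $BL$-algebra and $F:L\to[0,1]$ a fuzzy set. Then $F$ is an $(\overline{\in},\overline{\in}\vee\overline{q})$-fuzzy positive implicative filter of $L$ if and only if for every $t\in(0.5,1]$ for which $U(F;t)=\{x\in L\mid F(x)\ge t\}$ is non-empty, $U(F;t)$ is a positive implicative filter of $L$.
   Context: A $BL$-algebra is an algebra $(L,\le,\wedge,\vee,\odot,\rightarrow,0,1)$ that is a bounded lattice (least element $0$, greatest element $1$) such that $(L,\odot,1)$ is a commutative monoid, $z\le x\rightarrow y$ iff $x\odot z\le y$, $x\wedge y=x\odot(x\rightarrow y)$, and $(x\rightarrow y)\vee(y\rightarrow x)=1$, for all $x,y,z\in L$. A filter of $L$ is a non-empty subset $A\subseteq L$ with $1\in A$ such that $x\in A$ and $x\rightarrow y\in A$ imply $y\in A$; it is positive implicative if $x\rightarrow(y\rightarrow z)\in A$ and $x\rightarrow y\in A$ imply $x\rightarrow z\in A$ for all $x,y,z$. For $x\in L$ and $t\in(0,1]$, the fuzzy point $U(x;t)$ is said to belong to $F$, written $U(x;t)\in F$, if $F(x)\ge t$, and to be quasi-coincident with $F$, written $U(x;t)\,q\,F$, if $F(x)+t>1$; $\overline{\in}$ and $\overline{q}$ denote the negations of these relations, and $U(x;t)\,\overline{\in}\vee\overline{q}\,F$ means $U(x;t)\,\overline{\in}\,F$ or $U(x;t)\,\overline{q}\,F$. A fuzzy set $F$ is an $(\overline{\in},\overline{\in}\vee\overline{q})$-fuzzy filter of $L$ if for all $t,r\in(0,1]$ and $x,y\in L$: (i)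 if $U(x\odot y;\min\{t,r\})\,\overline{\in}\,F$ then $U(x;t)\,\overline{\in}\vee\overline{q}\,F$ or $U(y;r)\,\overline{\in}\vee\overline{q}\,F$; (ii) if $x\le y$ and $U(y;r)\,\overline{\in}\,F$ then $U(x;r)\,\overline{\in}\vee\overline{q}\,F$. It is an $(\overline{\in},\overline{\in}\vee\overline{q})$-fuzzy positive implicative filter if moreover $\max\{F(x\rightarrow z),0.5\}\ge\min\{F(x\rightarrow(y\rightarrow z)),F(x\rightarrow y)\}$ for all $x,y,z\in L$. *)

theory Defs
  imports Complex_Main
begin

text \<open>
  The constants 0 and 1 of the algebra are \<open>bot\<close> and \<open>1\<close>.  As \<open>bot = top\<close> is not excluded,
  the one-element algebra is included.
\<close>

class bl_algebra = bounded_lattice + comm_monoid_mult +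
  fixes residuum :: "'a \<Rightarrow> 'a \<Rightarrow> 'a"  (infixr "\<rightharpoonup>" 65)
  assumes one_eq_top: "1 = top"
    and residuation: "z \<le> (x \<rightharpoonup> y) \<longleftrightarrow> x * z \<le> y"
    and divisibility: "inf x y = x * (x \<rightharpoonup> y)"
    and prelinearity: "sup (x \<rightharpoonup> y) (y \<rightharpoonup> x) = 1"

definition bl_filter :: "'a::bl_algebra set \<Rightarrow> bool" where
  "bl_filter A \<longleftrightarrow> A \<noteq> {} \<and> 1 \<in> A \<and> (\<forall>x y. x \<in> A \<longrightarrow> (x \<rightharpoonup> y) \<in> A \<longrightarrow> y \<in> A)"

definition positive_implicative_filter :: "'a::bl_algebra set \<Rightarrow> bool" where
  "positive_implicative_filter A \<longleftrightarrow> bl_filter A \<and>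
     (\<forall>x y z. (x \<rightharpoonup> (y \<rightharpoonup> z)) \<in> A \<longrightarrow> (x \<rightharpoonup> y) \<in> A \<longrightarrow> (x \<rightharpoonup> z) \<in> A)"

text \<open>
  A fuzzy set is a function \<open>F\<close> with values in \<open>{0..1}\<close>. A fuzzy point \<open>U(x;t)\<close> is given by its
  support \<open>x\<close> and its value \<open>t\<close>. The relation \<open>notin_or_notq\<close> is the disjunction of the two
  negations, not the negation of ``belongs to or is quasi-coincident with''.
\<close>

definition fpoint_in :: "'a \<Rightarrow> real \<Rightarrow> ('a \<Rightarrow> real) \<Rightarrow> bool" where
  "fpoint_in x t F \<longleftrightarrow> F x \<ge> t"

definition fpoint_q :: "'a \<Rightarrow> real \<Rightarrow> ('a \<Rightarrow> real) \<Rightarrow> bool" where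
  "fpoint_q x t F \<longleftrightarrow> F x + t > 1"

definition notin_or_notq :: "'a \<Rightarrow> real \<Rightarrow> ('a \<Rightarrow> real) \<Rightarrow> bool" where
  "notin_or_notq x t F \<longleftrightarrow> \<not> fpoint_in x t F \<or> \<not> fpoint_q x t F"

definition notin_or_notq_fuzzy_filter :: "('a::bl_algebra \<Rightarrow> real) \<Rightarrow> bool" where
  "notin_or_notq_fuzzy_filter F \<longleftrightarrow>
     (\<forall>t\<in>{0<..1}. \<forall>r\<in>{0<..1}. \<forall>x y.
        (\<not> fpoint_in (x * y) (min t r) F \<longrightarrow> notin_or_notq x t F \<or> notin_or_notq y r F) \<and>
        (x \<le> y \<and> \<not> fpoint_in y r F \<longrightarrow> notin_or_notq x r F))"

definition notin_or_notq_fuzzy_positive_implicative_filter :: "('a::bl_algebra \<Rightarrow> real) \<Rightarrow> bool" where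
  "notin_or_notq_fuzzy_positive_implicative_filter F \<longleftrightarrow> notin_or_notq_fuzzy_filter F \<and>
     (\<forall>x y z. max (F (x \<rightharpoonup> z)) (1/2) \<ge> min (F (x \<rightharpoonup> (y \<rightharpoonup> z))) (F (x \<rightharpoonup> y)))"

definition level_set :: "('a \<Rightarrow> real) \<Rightarrow> real \<Rightarrow> 'a set" where
  "level_set F t = {x. F x \<ge> t}"

end

theory Submission
  imports Defs
begin

text \<open>
  A fuzzy point \<open>U(x;t)\<close> with \<open>F x \<ge> t\<close> and \<open>F x + t > 1\<close> forces \<open>F x > 1/2\<close>, and any \<open>t > 1/2\<close> with
  \<open>F x \<ge> t\<close> gives such a point. So the conditions on fuzzy points become inequalities between values
  of \<open>F\<close> in which the larger side is replaced by its maximum with \<open>1/2\<close>. Such an inequality says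
  that each level set above \<open>1/2\<close> is closed under the operation in question; to recover it from the
  level sets, take the smaller side as the threshold.
\<close>

lemma residuum_eq_one_iff: "x \<rightharpoonup> y = 1 \<longleftrightarrow> x \<le> (y::'a::bl_algebra)"
proof -
  have "x \<rightharpoonup> y = 1 \<longleftrightarrow> 1 \<le> x \<rightharpoonup> y"
    unfolding one_eq_top by (simp only: top_unique)
  then show ?thesis by (simp only: residuation mult_1_right)
qed

text \<open>Connects filters, defined by detachment, with fuzzy filters, whose conditions speak of
  product and order. Going up is detachment along \<open>x \<rightharpoonup> y = 1\<close>;
  conversely, detachment follows from closure under products because
  \<open>x * (x \<rightharpoonup> y) \<le> y\<close>.\<close>

lemma bl_filter_iff_up_closed_submonoid:
  fixes A :: "'a::bl_algebra set"
  shows "bl_filter A \<longleftrightarrow>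
    A \<noteq> {} \<and> (\<forall>x\<in>A. \<forall>y\<in>A. x * y \<in> A) \<and> (\<forall>x\<in>A. \<forall>y. x \<le> y \<longrightarrow> y \<in> A)"
proof
  assume A: "bl_filter A"
  then have one: "1 \<in> A" and mp: "x \<in> A \<Longrightarrow> x \<rightharpoonup> y \<in> A \<Longrightarrow> y \<in> A" for x y
    unfolding bl_filter_def by blast+
  have up: "y \<in> A" if "x \<in> A" "x \<le> y" for x y
    using that mp[of x y] one by (simp only: residuum_eq_one_iff[THEN iffD2])
  have "x * y \<in> A" if "x \<in> A" "y \<in> A" for x y
  proof -
    \<comment> \<open>By residuation this is just \<open>y * x \<le> x * y\<close>. Going up from
      \<open>x\<close> and detaching \<open>y\<close> then yields the product.\<close>
    have "x \<le> y \<rightharpoonup> x * y"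
      by (simp add: residuation mult.commute)
    with that show ?thesis
      using up mp by blast
  qed
  with one up show "A \<noteq> {} \<and> (\<forall>x\<in>A. \<forall>y\<in>A. x * y \<in> A) \<and> (\<forall>x\<in>A. \<forall>y. x \<le> y \<longrightarrow> y \<in> A)"
    by blast
next
  assume A: "A \<noteq> {} \<and> (\<forall>x\<in>A. \<forall>y\<in>A. x * y \<in> A) \<and> (\<forall>x\<in>A. \<forall>y. x \<le> y \<longrightarrow> y \<in> A)"
  have le_one: "x \<le> 1" for x :: 'a
    by (simp only: one_eq_top top_greatest)
  have "1 \<in> A"
    using A le_one by blast
  moreover have "y \<in> A" if "x \<in> A" "x \<rightharpoonup> y \<in> A" for x y
  proof -
    have "x * (x \<rightharpoonup> y) \<le> y"
      using inf_le2[of x y] by (simp only: divisibility)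
    with A that show ?thesis by blast
  qed
  ultimately show "bl_filter A"
    using A unfolding bl_filter_def by blast
qed

text \<open>A violated inequality yields fuzzy points that violate the definition, with values of
  \<open>F\<close> as their values; the bound \<open>F x \<le> 1\<close> makes these
  admissible.\<close>

lemma notin_or_notq_fuzzy_filter_iff:
  fixes F :: "'a::bl_algebra \<Rightarrow> real"
  assumes F: "\<And>x. F x \<in> {0..1}"
  shows "notin_or_notq_fuzzy_filter F \<longleftrightarrow>
    (\<forall>x y. min (F x) (F y) \<le> max (F (x * y)) (1/2)) \<and>
    (\<forall>x y. x \<le> y \<longrightarrow> F x \<le> max (F y) (1/2))"
proof
  assume *: "notin_or_notq_fuzzy_filter F"
  show "(\<forall>x y. min (F x) (F y) \<le> max (F (x * y)) (1/2)) \<and>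
    (\<forall>x y. x \<le> y \<longrightarrow> F x \<le> max (F y) (1/2))"
  proof (intro conjI allI impI; rule ccontr)
    fix x y
    assume "\<not> min (F x) (F y) \<le> max (F (x * y)) (1/2)"
    \<comment> \<open>Using \<open>m\<close> for both \<open>t\<close> and \<open>r\<close> keeps
      \<open>min t r = m\<close>. Since \<open>1/2 < m\<close>, both points belong to
      \<open>F\<close> and are quasi-coincident with it, but the point at the product does not
      belong.\<close>
    moreover define m where "m = min (F x) (F y)"
    moreover have "m \<le> 1" using F[of x] by (simp add: m_def min_le_iff_disj)
    ultimately have m: "m \<in> {0<..1}" "F (x * y) < m" "1/2 < m" "m \<le> F x" "m \<le> F y"
      by auto
    then show False
      using *[unfolded notin_or_notq_fuzzy_filter_def, rule_format, of m m x y]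
      by (auto simp: notin_or_notq_def fpoint_in_def fpoint_q_def)
  next
    fix x y
    assume "x \<le> y" "\<not> F x \<le> max (F y) (1/2)"
    moreover from this have "F x \<in> {0<..1}" using F[of x] by auto
    ultimately show False
      using *[unfolded notin_or_notq_fuzzy_filter_def, rule_format, of "F x" "F x" x y]
      by (auto simp: notin_or_notq_def fpoint_in_def fpoint_q_def)
  qed
next
  assume *: "(\<forall>x y. min (F x) (F y) \<le> max (F (x * y)) (1/2)) \<and>
    (\<forall>x y. x \<le> y \<longrightarrow> F x \<le> max (F y) (1/2))"
  show "notin_or_notq_fuzzy_filter F"
    unfolding notin_or_notq_fuzzy_filter_def notin_or_notq_def fpoint_in_def fpoint_q_def
  proof (intro ballI allI conjI impI)
    fix t r :: real and x y
    assume "\<not> min t r \<le> F (x * y)"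
    \<comment> \<open>Otherwise \<open>2 * F x \<ge> F x + t > 1\<close>, and likewise for
      \<open>y\<close>, so the \<open>1/2\<close> in the maximum cannot be the bound and
      \<open>min t r \<le> F (x * y)\<close> follows.\<close>
    then show "(\<not> t \<le> F x \<or> \<not> 1 < F x + t) \<or> \<not> r \<le> F y \<or> \<not> 1 < F y + r"
      using *[THEN conjunct1, rule_format, of x y] by (auto simp: min_def max_def split: if_splits)
  next
    fix r :: real and x y
    assume "x \<le> y \<and> \<not> r \<le> F y"
    then show "\<not> r \<le> F x \<or> \<not> 1 < F x + r"
      using *[THEN conjunct2, rule_format, of x y] by (auto simp: max_def split: if_splits)
  qed
qed

theorem theorem3p2p4:
  fixes F :: "'a::bl_algebra \<Rightarrow> real"
  assumes "\<And>x. F x \<in> {0..1}"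
  shows "notin_or_notq_fuzzy_positive_implicative_filter F \<longleftrightarrow>
    (\<forall>t\<in>{1/2<..1}. level_set F t \<noteq> {} \<longrightarrow> positive_implicative_filter (level_set F t))"
proof
  assume "notin_or_notq_fuzzy_positive_implicative_filter F"
  then have mult: "min (F x) (F y) \<le> max (F (x * y)) (1/2)"
    and mono: "x \<le> y \<Longrightarrow> F x \<le> max (F y) (1/2)"
    and impl: "min (F (x \<rightharpoonup> (y \<rightharpoonup> z))) (F (x \<rightharpoonup> y)) \<le> max (F (x \<rightharpoonup> z)) (1/2)" for x y z
    by (simp_all add: notin_or_notq_fuzzy_positive_implicative_filter_def
        notin_or_notq_fuzzy_filter_iff[OF assms])
  show "\<forall>t\<in>{1/2<..1}. level_set F t \<noteq> {} \<longrightarrow> positive_implicative_filter (level_set F t)"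
  proof (intro ballI impI)
    fix t :: real
    assume t: "t \<in> {1/2<..1}" and ne: "level_set F t \<noteq> {}"
    \<comment> \<open>Because \<open>t > 1/2\<close>, a maximum with \<open>1/2\<close> that reaches
      \<open>t\<close> must do so through the value of \<open>F\<close>.\<close>
    have "F (x * y) \<ge> t" if "F x \<ge> t" "F y \<ge> t" for x y
      using mult[of x y] t that by (auto simp: le_max_iff_disj min_le_iff_disj)
    moreover have "F y \<ge> t" if "F x \<ge> t" "x \<le> y" for x y
      using mono[of x y] t that by (auto simp: le_max_iff_disj)
    moreover have "F (x \<rightharpoonup> z) \<ge> t" if "F (x \<rightharpoonup> (y \<rightharpoonup> z)) \<ge> t" "F (x \<rightharpoonup> y) \<ge> t" for x y z
      using impl[of x y z] t that by (auto simp: le_max_iff_disj min_le_iff_disj)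
    ultimately show "positive_implicative_filter (level_set F t)"
      using ne unfolding positive_implicative_filter_def bl_filter_iff_up_closed_submonoid
      by (auto simp: level_set_def)
  qed
next
  assume *: "\<forall>t\<in>{1/2<..1}. level_set F t \<noteq> {} \<longrightarrow> positive_implicative_filter (level_set F t)"
  \<comment> \<open>Here \<open>x\<close> witnesses that the level set is non-empty, and
    \<open>t \<le> F x \<le> 1\<close> puts \<open>t\<close> in range.\<close>
  have level: "positive_implicative_filter (level_set F t)" if "1/2 < t" "t \<le> F x" for t x
  proof -
    have "t \<in> {1/2<..1}" "x \<in> level_set F t"
      using that assms[of x] by (auto simp: level_set_def)
    with * show ?thesis by blast
  qed
  have mult: "min (F x) (F y) \<le> max (F (x * y)) (1/2)" (is "?m \<le> _") for x y
  \<comment> \<open>If \<open>?m \<le> 1/2\<close>, the \<open>1/2\<close> on the right already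
    suffices; otherwise \<open>?m\<close> is an admissible threshold that both \<open>x\<close> and
    \<open>y\<close> reach.\<close>
  proof (cases "1/2 < ?m")
    case True
    then have "bl_filter (level_set F ?m)"
      using level[of ?m x] by (simp add: positive_implicative_filter_def)
    moreover have "x \<in> level_set F ?m" "y \<in> level_set F ?m"
      by (simp_all add: level_set_def)
    ultimately have "x * y \<in> level_set F ?m"
      by (simp add: bl_filter_iff_up_closed_submonoid)
    then show ?thesis by (simp add: level_set_def le_max_iff_disj)
  qed (simp only: le_max_iff_disj not_less simp_thms)
  have mono: "F x \<le> max (F y) (1/2)" if "x \<le> y" for x y
  proof (cases "1/2 < F x")
    case True
    then have "bl_filter (level_set F (F x))"
      using level[of "F x" x] by (simp add: positive_implicative_filter_def)
    moreover have "x \<in> level_set F (F x)"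
      by (simp add: level_set_def)
    ultimately have "y \<in> level_set F (F x)"
      using that unfolding bl_filter_iff_up_closed_submonoid by blast
    then show ?thesis by (simp add: level_set_def)
  qed simp
  have impl: "min (F (x \<rightharpoonup> (y \<rightharpoonup> z))) (F (x \<rightharpoonup> y)) \<le> max (F (x \<rightharpoonup> z)) (1/2)" (is "?m \<le> _")
    for x y z
  proof (cases "1/2 < ?m")
    case True
    then have "positive_implicative_filter (level_set F ?m)"
      \<comment> \<open>The element \<open>x \<rightharpoonup> y\<close> serves as the witness, as
        its value is one of the two arguments of the minimum \<open>?m\<close>.\<close>
      by (intro level[of _ "x \<rightharpoonup> y"]) auto
    moreover have "x \<rightharpoonup> (y \<rightharpoonup> z) \<in> level_set F ?m" "x \<rightharpoonup> y \<in> level_set F ?m"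
      by (simp_all add: level_set_def)
    ultimately have "x \<rightharpoonup> z \<in> level_set F ?m"
      unfolding positive_implicative_filter_def by blast
    then show ?thesis by (simp add: level_set_def le_max_iff_disj)
  qed (simp only: le_max_iff_disj not_less simp_thms)
  from mult mono impl show "notin_or_notq_fuzzy_positive_implicative_filter F"
    unfolding notin_or_notq_fuzzy_positive_implicative_filter_def
      notin_or_notq_fuzzy_filter_iff[OF assms] by blast
qed

end
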